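(* Let $a,b,n$ be positive integers with $a\le b$, and let $G=\mathcal{F}(n;a,b)$. Then: 1. If $a=b$, then $\mathrm{aw}(G)=0$ for all $n$. 2. If $a<b$, then $\mathrm{aw}(G)=-\lceil n/a\rceil+1$ for all $n$.
   Context: Games are short two-player combinatorial games (players Left and Right) under normal play: a player unable to move on their turn loses. Full Support (FS): for positive integers $a,b$ and an integer $n\ge 0$, $\mathcal{F}(n;a,b)$ is the game played on one heap of $n$ pebbles in which Left, on her turn, may remove any number $i\in\{1,\dots,a\}$ of pebbles with $i\le n$, and Right, on his turn, may remove any number $j\in\{1,\dots,b\}$ with $j\le n$. Atomic weight: $*m$ denotes the nimber of size $m$, with $*0=0$ and $*=*1$. Up is $\uparrow=\{0\mid *\}$ and down is $\downarrow=-\uparrow=\{*\mid 0\}$. For an integer $w$, $w\cdot\uparrow$ is the disjunctive sum of $w$ copies of $\uparrow$ if $w\ge 0$, and of $|w|$ copies of $\downarrow$ if $w<0$. Far star, written ☆, stands for a nimber $*m$ whose birthday is larger than that of the games added to it (i.e. $m$ sufficiently large). Two games $G,H$ are equivalent under ☆, written $G\sim_{☆}H$, if for every short game $X$ the outcomes of $G+X+☆$ and $H+X+☆$ coincide. Equivalently, $\downarrow+☆<G-H<\uparrow+☆$. For an integer $w$, $\mathrm{aw}(G)=w$ means that $G\sim_{☆}w\cdot\uparrow$; such a $w$ is unique if it exists. *)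

theory Defs
  imports Complex_Main "HOL-Library.FSet"
begin

section \<open>Short partizan games under normal play\<close>

declare fimage_cong [fundef_cong]

datatype game = Game (left_opts: "game fset") (right_opts: "game fset")

datatype player = Left | Right

fun opponent :: "player \<Rightarrow> player" where
  "opponent Left = Right"
| "opponent Right = Left"

fun options :: "player \<Rightarrow> game \<Rightarrow> game fset" where
  "options Left G = left_opts G"
| "options Right G = right_opts G"

lemma size_left_option: "X |\<in>| left_opts G \<Longrightarrow> size X < size G"
proof (cases G)
  case (Game L R)
  assume "X |\<in>| left_opts G"
  then have "Suc (size X) \<le> (\<Sum>x\<in>fset L. Suc (size x))"
    using Game by (intro member_le_sum[where f = "\<lambda>x. Suc (size x)"]) auto
  then show ?thesis
    using Game by simp
qed

lemma size_right_option: "X |\<in>| right_opts G \<Longrightarrow> size X < size G"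
proof (cases G)
  case (Game L R)
  assume "X |\<in>| right_opts G"
  then have "Suc (size X) \<le> (\<Sum>x\<in>fset R. Suc (size x))"
    using Game by (intro member_le_sum[where f = "\<lambda>x. Suc (size x)"]) auto
  then show ?thesis
    using Game by simp
qed

lemma size_option: "X |\<in>| options p G \<Longrightarrow> size X < size G"
  by (cases p) (auto simp: size_left_option size_right_option)

text \<open>
  \<open>wins_moving_first p G\<close>: player \<open>p\<close> wins \<open>G\<close> when it is \<open>p\<close>'s turn.
  A player without options loses.
\<close>

function wins_moving_first :: "player \<Rightarrow> game \<Rightarrow> bool" where
  "wins_moving_first p G \<longleftrightarrow> fBex (options p G) (\<lambda>G'. \<not> wins_moving_first (opponent p) G')"
  by auto
termination
  by (relation "measure (size \<circ> snd)") (auto simp: size_option)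

declare wins_moving_first.simps [simp del]

text \<open>
  The outcome of a game records, for each of the two possible starting players, who wins;
  its four values are the classes usually called L, R, N (next) and P (previous).
\<close>

datatype outcome = LeftWins | RightWins | NextWins | PreviousWins

definition outcome :: "game \<Rightarrow> outcome" where
  "outcome G =
     (if wins_moving_first Left G
      then (if wins_moving_first Right G then NextWins else LeftWins)
      else (if wins_moving_first Right G then RightWins else PreviousWins))"

instantiation game :: "{zero, plus, uminus}"
begin

definition zero_game :: game where
  "0 = Game {||} {||}"

function plus_game :: "game \<Rightarrow> game \<Rightarrow> game" where
  "plus_game G H =
     Game ((\<lambda>X. plus_game X H) |`| left_opts G |\<union>| (\<lambda>Y. plus_game G Y) |`| left_opts H)
          ((\<lambda>X. plus_game X H) |`| right_opts G |\<union>| (\<lambda>Y. plus_game G Y) |`| right_opts H)"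
  by auto
termination
  by (relation "measure (\<lambda>(G, H). size G + size H)")
     (auto simp: size_left_option size_right_option)

primrec uminus_game :: "game \<Rightarrow> game" where
  "uminus_game (Game L R) = Game (uminus_game |`| R) (uminus_game |`| L)"

instance ..

end

declare plus_game.simps [simp del]

primrec birthday :: "game \<Rightarrow> nat" where
  "birthday (Game L R) = fMax (finsert 0 (Suc |`| (birthday |`| L |\<union>| birthday |`| R)))"


section \<open>Nimbers, integer multiples of up, and atomic weight\<close>

function nimber :: "nat \<Rightarrow> game" where
  "nimber m = Game (nimber |`| fset_of_list [0..<m]) (nimber |`| fset_of_list [0..<m])"
  by auto
termination
  by (relation "measure id") (auto simp: fset_of_list.rep_eq)

declare nimber.simps [simp del]

lemma birthday_nimber: "birthday (nimber m) = m"
proof (induction m rule: less_induct)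
  case (less m)
  let ?A = "fset_of_list [0..<m]"
  have "birthday |`| nimber |`| ?A = (\<lambda>x. x) |`| ?A"
    unfolding fset.map_comp
    by (rule fimage_cong) (auto simp: less.IH fset_of_list_elem)
  then have "birthday (nimber m) = fMax (finsert 0 (Suc |`| ?A))"
    by (subst nimber.simps) (simp del: fMax_finsert fset_of_list_map upt_conv_Cons upt_Suc)
  also have "\<dots> = m"
    by (cases m) (auto intro!: fMax_eqI simp: fset_of_list_elem simp del: fMax_finsert upt_Suc)
  finally show ?case .
qed

definition up :: game where
  "up = Game {|0|} {|nimber 1|}"

definition down :: game where
  "down = - up"

lemma nimber_0: "nimber 0 = 0"
  by (subst nimber.simps) (simp add: zero_game_def)

lemma nimber_1: "nimber 1 = Game {|0|} {|0|}"
  by (subst nimber.simps) (simp add: nimber_0)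

lemma down_eq: "down = Game {|nimber 1|} {|0|}"
proof -
  have "- 0 = (0 :: game)"
    by (simp add: zero_game_def)
  then show ?thesis
    by (simp add: down_def up_def nimber_1 del: One_nat_def)
qed

definition copies :: "nat \<Rightarrow> game \<Rightarrow> game" where
  "copies k G = ((\<lambda>H. G + H) ^^ k) 0"

definition up_multiple :: "int \<Rightarrow> game" where
  "up_multiple w = (if 0 \<le> w then copies (nat w) up else copies (nat (- w)) down)"

text \<open>
  Equivalence under far star. For each test game \<open>X\<close>, the far star is any nimber whose birthday
  exceeds the birthdays of the two games \<open>G + X\<close> and \<open>H + X\<close> that it is added to. Bounding it
  by the birthdays of \<open>G\<close>, \<open>H\<close> and \<open>X\<close> separately would not do: \<open>nimber 2 + nimber 1\<close> is equal
  in value to \<open>nimber 3\<close>.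
\<close>

definition far_star_equiv :: "game \<Rightarrow> game \<Rightarrow> bool" where
  "far_star_equiv G H \<longleftrightarrow>
     (\<forall>X m. birthday (G + X) < birthday (nimber m) \<and> birthday (H + X) < birthday (nimber m) \<longrightarrow>
        outcome (G + X + nimber m) = outcome (H + X + nimber m))"

text \<open>
  Not every game has an integer atomic weight, so the equation \<open>aw(G) = w\<close> is a relation.
\<close>

definition has_atomic_weight :: "game \<Rightarrow> int \<Rightarrow> bool" where
  "has_atomic_weight G w \<longleftrightarrow> far_star_equiv G (up_multiple w)"


section \<open>Full Support\<close>

function full_support :: "nat \<Rightarrow> nat \<Rightarrow> nat \<Rightarrow> game" where
  "full_support n a b =
     Game ((\<lambda>i. full_support (n - i) a b) |`| ffilter (\<lambda>i. i \<le> n) (fset_of_list [1..<Suc a]))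
          ((\<lambda>j. full_support (n - j) a b) |`| ffilter (\<lambda>j. j \<le> n) (fset_of_list [1..<Suc b]))"
  by auto
termination
  by (relation "measure (\<lambda>(n, a, b). n)") (auto simp: fset_of_list.rep_eq)

declare full_support.simps [simp del]

end

theory Submission
  imports Defs "HOL-Library.Infinite_Set"
begin

text \<open>
  Write \<open>F n\<close> for the Full Support game on \<open>n\<close> pebbles.

  If \<open>a = b\<close>, both players always have the same moves, so \<open>F n\<close> is impartial, its value is a
  nimber (\<open>impartial_value_nimber\<close>), and a far star absorbs nimbers: \<open>*c\<close> plus a far star is again
  a far star.

  Let \<open>a < b\<close> and \<open>k a < n \<le> (k + 1) a\<close>, so that the claim is that \<open>F n\<close> has atomic weight \<open>-k\<close>.
  The proof plays out two games with a far star. In \<open>F n\<close> plus \<open>k + 1\<close> ups plus a far star, Left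
  wins moving second (\<open>left_far_wins\<close>): one move by \<open>a\<close> pebbles makes up for the loss of one up,
  and as soon as at most \<open>a\<close> pebbles are left, the heap is a nimber that the star can cancel. In
  \<open>F n\<close> plus \<open>k - 1\<close> ups plus a far star, Right wins moving second (\<open>right_far_wins\<close> and, for
  \<open>k = 0\<close>, \<open>right_far_wins_down\<close>): he answers each move of Left that removes up to \<open>a\<close> pebbles by
  turning an up into a star, and with no ups left he relies on \<open>F m\<close> being at most \<open>0\<close> for all
  \<open>m > a\<close>, where the extra move \<open>a + 1 \<le> b\<close> is what favours him.

  That these two facts bound the difference between \<open>F n\<close> and \<open>k\<close> downs strictly between one down
  plus far star and one up plus far star, and that this gives equal outcomes in every context, is
  \<open>far_star_equivI\<close>. Its core is \<open>far_wins_add_arrow\<close>: two games that are both at least every far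
  star still have a sum of this kind after the opponent is given one arrow. Here "every far star"
  is expressed by "all but finitely many nimbers". The bridge to the definition with birthdays is
  that the outcome of \<open>Z + *m\<close> is the same for all \<open>m\<close> above the birthday of \<open>Z\<close>
  (\<open>far_star_independent\<close>).
\<close>

section \<open>Games as a commutative monoid with negation\<close>

lemma opponent_opponent [simp]: "opponent (opponent p) = p"
  by (cases p) auto

lemma game_eqI: "(\<And>p. options p G = options p H) \<Longrightarrow> G = H"
  using options.simps by (metis game.expand)

lemma options_add:
  "options p (G + H) = (\<lambda>X. X + H) |`| options p G |\<union>| (\<lambda>Y. G + Y) |`| options p H"
  by (cases p) (simp_all add: plus_game.simps [of G H])

lemma mem_options_add:
  "X |\<in>| options p (G + H) \<longleftrightarrow>
     (\<exists>G'. G' |\<in>| options p G \<and> X = G' + H) \<or> (\<exists>H'. H' |\<in>| options p H \<and> X = G + H')"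
  unfolding options_add by auto

lemma options_zero [simp]: "options p 0 = {||}"
  by (cases p) (auto simp: zero_game_def)

instance game :: comm_monoid_add
proof
  fix G H K :: game
  show "G + H + K = G + (H + K)"
  proof (induction "size G + size H + size K" arbitrary: G H K rule: less_induct)
    case less
    show ?case
    proof (rule game_eqI)
      fix p
      have 1: "G' + H + K = G' + (H + K)" if "G' |\<in>| options p G" for G'
        using less size_option [OF that] by simp
      have 2: "G + H' + K = G + (H' + K)" if "H' |\<in>| options p H" for H'
        using less size_option [OF that] by simp
      have 3: "G + H + K' = G + (H + K')" if "K' |\<in>| options p K" for K'
        using less size_option [OF that] by simp
      show "options p (G + H + K) = options p (G + (H + K))"
        by (intro fset_eqI) (auto simp: mem_options_add 1 2 3; metis 1 2 3)
    qed
  qed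
  show "G + H = H + G"
  proof (induction "size G + size H" arbitrary: G H rule: less_induct)
    case less
    show ?case
    proof (rule game_eqI)
      fix p
      have 1: "G' + H = H + G'" if "G' |\<in>| options p G" for G'
        using less size_option [OF that] by simp
      have 2: "G + H' = H' + G" if "H' |\<in>| options p H" for H'
        using less size_option [OF that] by simp
      show "options p (G + H) = options p (H + G)"
        by (intro fset_eqI) (auto simp: mem_options_add 1 2; metis 1 2)
    qed
  qed
  show "0 + G = G"
  proof (induction "size G" arbitrary: G rule: less_induct)
    case less
    show ?case
    proof (rule game_eqI)
      fix p
      have 1: "0 + G' = G'" if "G' |\<in>| options p G" for G'
        using less size_option [OF that] by simp
      show "options p (0 + G) = options p G"
        by (intro fset_eqI) (auto simp: mem_options_add 1; metis 1)
    qed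
  qed
qed

lemma options_uminus: "options p (- G) = uminus |`| options (opponent p) G"
  by (cases p; cases G) auto

declare options.simps [simp del]

lemma uminus_uminus [simp]: "- (- G) = (G :: game)"
proof (induction "size G" arbitrary: G rule: less_induct)
  case less
  show ?case
  proof (rule game_eqI)
    fix p
    have 1: "- (- G') = G'" if "G' |\<in>| options p G" for G'
      using less size_option [OF that] by simp
    show "options p (- (- G)) = options p G"
      by (intro fset_eqI) (auto simp: options_uminus 1 image_iff; metis 1)
  qed
qed

lemma uminus_add: "- (G + H) = - G + - (H :: game)"
proof (induction "size G + size H" arbitrary: G H rule: less_induct)
  case less
  show ?case
  proof (rule game_eqI)
    fix p
    let ?o = "opponent p"
    have 1: "- (G' + H) = - G' + - H" if "G' |\<in>| options ?o G" for G'
      using less size_option [OF that] by simp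
    have 2: "- (G + H') = - G + - H'" if "H' |\<in>| options ?o H" for H'
      using less size_option [OF that] by simp
    show "options p (- (G + H)) = options p (- G + - H)"
      unfolding options_add options_uminus fimage_funion fset.map_comp
      by (intro arg_cong2 [where f = "(|\<union>|)"] fimage_cong) (auto simp: 1 2)
  qed
qed


section \<open>Winning moving second, and equality of values\<close>

abbreviation wins_second :: "player \<Rightarrow> game \<Rightarrow> bool" where
  "wins_second p G \<equiv> \<not> wins_moving_first (opponent p) G"

lemma wins_first_iff:
  "wins_moving_first p G \<longleftrightarrow> (\<exists>G'. G' |\<in>| options p G \<and> wins_second p G')"
  by (subst wins_moving_first.simps) auto

lemma wins_second_iff:
  "wins_second p G \<longleftrightarrow> (\<forall>G'. G' |\<in>| options (opponent p) G \<longrightarrow> wins_moving_first p G')"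
  by (subst wins_moving_first.simps) auto

lemma wins_firstI: "G' |\<in>| options p G \<Longrightarrow> wins_second p G' \<Longrightarrow> wins_moving_first p G"
  using wins_first_iff by blast

lemma wins_first_addI1:
  "G' |\<in>| options p G \<Longrightarrow> wins_second p (G' + H) \<Longrightarrow> wins_moving_first p (G + H)"
  by (rule wins_firstI) (auto simp: mem_options_add)

lemma wins_first_addI2:
  "H' |\<in>| options p H \<Longrightarrow> wins_second p (G + H') \<Longrightarrow> wins_moving_first p (G + H)"
  by (rule wins_firstI) (auto simp: mem_options_add)

lemma wins_first_add_cases:
  assumes "wins_moving_first p (G + H)"
  obtains (left) G' where "G' |\<in>| options p G" "wins_second p (G' + H)"
  | (right) H' where "H' |\<in>| options p H" "wins_second p (G + H')"
  using assms by (subst (asm) wins_first_iff) (auto simp: mem_options_add)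

lemma wins_second_addI:
  assumes "\<And>G'. G' |\<in>| options (opponent p) G \<Longrightarrow> wins_moving_first p (G' + H)"
    and "\<And>H'. H' |\<in>| options (opponent p) H \<Longrightarrow> wins_moving_first p (G + H')"
  shows "wins_second p (G + H)"
  using assms by (auto simp: wins_second_iff [of p] mem_options_add)

lemma not_wins_first_zero [simp]: "\<not> wins_moving_first p 0"
  by (subst wins_first_iff) simp

text \<open>Answering in the summand in which the opponent has just moved wins the sum.\<close>

lemma wins_second_add:
  "wins_second p G \<Longrightarrow> wins_second p H \<Longrightarrow> wins_second p (G + H)"
proof (induction "size G + size H" arbitrary: G H rule: less_induct)
  case less
  show ?case
  proof (rule wins_second_addI)
    fix G' assume G': "G' |\<in>| options (opponent p) G"
    then obtain G'' where G'': "G'' |\<in>| options p G'" "wins_second p G''"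
      using less.prems(1) by (metis wins_second_iff wins_first_iff)
    have "size G'' < size G"
      using size_option [OF G'] size_option [OF G''(1)] by simp
    then show "wins_moving_first p (G' + H)"
      using G'' less by (intro wins_first_addI1 [of G'']) auto
  next
    fix H' assume H': "H' |\<in>| options (opponent p) H"
    then obtain H'' where H'': "H'' |\<in>| options p H'" "wins_second p H''"
      using less.prems(2) by (metis wins_second_iff wins_first_iff)
    have "size H'' < size H"
      using size_option [OF H'] size_option [OF H''(1)] by simp
    then show "wins_moving_first p (G + H')"
      using H'' less by (intro wins_first_addI2 [of H'']) auto
  qed
qed

lemma wins_first_add:
  assumes "wins_moving_first p G" "wins_second p H"
  shows "wins_moving_first p (G + H)"
proof -
  obtain G' where "G' |\<in>| options p G" "wins_second p G'"
    using assms(1) by (auto simp: wins_first_iff [of p])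
  then show ?thesis
    using wins_first_addI1 wins_second_add assms(2) by blast
qed

definition is_zero :: "game \<Rightarrow> bool" where
  "is_zero A \<longleftrightarrow> (\<forall>p. \<not> wins_moving_first p A)"

lemma is_zeroI:
  assumes "\<And>p. wins_second p A"
  shows "is_zero A"
  using assms [of "opponent _"] by (simp add: is_zero_def)

lemma wins_first_add_zero:
  assumes "is_zero A"
  shows "wins_moving_first p (A + X) \<longleftrightarrow> wins_moving_first p X"
proof
  show "wins_moving_first p (A + X)" if "wins_moving_first p X"
    using wins_first_add [OF that, of A] assms by (auto simp: is_zero_def add.commute)
  show "wins_moving_first p X" if "wins_moving_first p (A + X)"
    using wins_second_add [of "opponent p" A X] that assms
    by (auto simp: is_zero_def)
qed

text \<open>
  Equality of values is taken in its observational form, so that it is a congruence for addition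
  by construction.
\<close>

definition value_eq :: "game \<Rightarrow> game \<Rightarrow> bool"  (infix "\<simeq>" 50) where
  "G \<simeq> H \<longleftrightarrow> (\<forall>X p. wins_moving_first p (G + X) \<longleftrightarrow> wins_moving_first p (H + X))"

lemma value_eq_refl [simp]: "G \<simeq> G"
  by (simp add: value_eq_def)

lemma value_eq_sym: "G \<simeq> H \<Longrightarrow> H \<simeq> G"
  by (simp add: value_eq_def)

lemma value_eq_trans [trans]: "G \<simeq> H \<Longrightarrow> H \<simeq> K \<Longrightarrow> G \<simeq> K"
  by (simp add: value_eq_def)

lemma value_eq_add: "G \<simeq> H \<Longrightarrow> G + X \<simeq> H + X"
  by (simp add: value_eq_def add.assoc)

lemma value_eq_wins: "G \<simeq> H \<Longrightarrow> wins_moving_first p G \<longleftrightarrow> wins_moving_first p H"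
  unfolding value_eq_def by (metis add.right_neutral)

lemma value_eq_add_zero: "is_zero A \<Longrightarrow> A + G \<simeq> G"
  by (simp add: value_eq_def add.assoc wins_first_add_zero)

lemma value_eq_is_zero: "G \<simeq> H \<Longrightarrow> is_zero G \<longleftrightarrow> is_zero H"
  by (simp add: is_zero_def value_eq_wins)

lemma is_zero_add: "is_zero A \<Longrightarrow> is_zero B \<Longrightarrow> is_zero (A + B)"
  by (intro is_zeroI wins_second_add) (auto simp: is_zero_def)

lemma value_eqI:
  assumes "is_zero (G + K)" "is_zero (K + H)"
  shows "G \<simeq> H"
proof -
  have "(K + H) + G \<simeq> G" "(G + K) + H \<simeq> H"
    using assms value_eq_add_zero by blast+
  moreover have "(K + H) + G = (G + K) + H"
    by (simp add: ac_simps)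
  ultimately show ?thesis
    by (metis value_eq_sym value_eq_trans)
qed

text \<open>The mirror strategy, also known as Tweedledum--Tweedledee.\<close>

lemma is_zero_add_uminus: "is_zero (G + - G)"
proof -
  have "wins_second p (G + - G)" for p
  proof (induction "size G" arbitrary: G rule: less_induct)
    case less
    show ?case
    proof (rule wins_second_addI)
      fix G' assume G': "G' |\<in>| options (opponent p) G"
      then show "wins_moving_first p (G' + - G)"
        using less size_option [OF G']
        by (intro wins_first_addI2 [of "- G'"]) (auto simp: options_uminus)
    next
      fix H assume "H |\<in>| options (opponent p) (- G)"
      then obtain G' where G': "G' |\<in>| options p G" "H = - G'"
        by (auto simp: options_uminus)
      then show "wins_moving_first p (G + H)"
        using less size_option [OF G'(1)]
        by (intro wins_first_addI1 [of "G'"]) auto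
    qed
  qed
  then show ?thesis
    by (rule is_zeroI)
qed

lemma wins_first_uminus: "wins_moving_first p (- G) \<longleftrightarrow> wins_moving_first (opponent p) G"
proof (induction "size G" arbitrary: p G rule: less_induct)
  case less
  have IH: "wins_second p (- G') \<longleftrightarrow> wins_second (opponent p) G'"
    if "G' |\<in>| options (opponent p) G" for G'
    using less size_option [OF that] by simp
  have "wins_moving_first p (- G) \<longleftrightarrow>
      (\<exists>G'. G' |\<in>| options (opponent p) G \<and> wins_second p (- G'))"
    by (subst wins_first_iff) (auto simp: options_uminus)
  also have "\<dots> \<longleftrightarrow> (\<exists>G'. G' |\<in>| options (opponent p) G \<and> wins_second (opponent p) G')"
    using IH by blast
  also have "\<dots> \<longleftrightarrow> wins_moving_first (opponent p) G"
    by (rule wins_first_iff [symmetric])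
  finally show ?case .
qed


section \<open>Impartial games are nimbers\<close>

lemma mem_options_nimber [simp]:
  "X |\<in>| options p (nimber m) \<longleftrightarrow> (\<exists>j<m. X = nimber j)"
  by (cases p; subst nimber.simps) (auto simp: options.simps fset_of_list_elem)

lemma uminus_nimber [simp]: "- nimber m = nimber m"
proof (induction m rule: less_induct)
  case (less m)
  show ?case
    by (rule game_eqI, rule fset_eqI)
       (auto simp: options_uminus image_iff less; metis less mem_options_nimber)
qed

lemma is_zero_nimber_double: "is_zero (nimber m + nimber m)"
  using is_zero_add_uminus [of "nimber m"] by simp

lemma wins_first_nimber_pair:
  assumes "c \<noteq> d"
  shows "wins_moving_first p (nimber c + nimber d)"
proof (cases "c < d")
  case True
  then show ?thesis
    using is_zero_nimber_double [of c]
    by (intro wins_first_addI2 [of "nimber c"]) (auto simp: is_zero_def)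
next
  case False
  then show ?thesis
    using is_zero_nimber_double [of d] assms
    by (intro wins_first_addI1 [of "nimber d"]) (auto simp: is_zero_def intro: exI [of _ d])
qed

lemma value_eq_nimber_iff: "nimber c \<simeq> nimber d \<longleftrightarrow> c = d"
proof
  assume "nimber c \<simeq> nimber d"
  then have "wins_moving_first Left (nimber c + nimber d)
      \<longleftrightarrow> wins_moving_first Left (nimber d + nimber d)"
    by (intro value_eq_wins value_eq_add)
  moreover have "\<not> wins_moving_first Left (nimber d + nimber d)"
    using is_zero_nimber_double [of d] unfolding is_zero_def by blast
  ultimately show "c = d"
    using wins_first_nimber_pair by blast
qed simp

inductive impartial :: "game \<Rightarrow> bool" where
  impartialI: "options Left G = options Right G \<Longrightarrow>
    (\<And>G'. G' |\<in>| options Left G \<Longrightarrow> impartial G') \<Longrightarrow> impartial G"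

lemma options_impartial:
  assumes "impartial G"
  shows "options p G = options Left G"
  using assms by (cases p) (auto elim: impartial.cases)

lemma impartial_option: "impartial G \<Longrightarrow> G' |\<in>| options p G \<Longrightarrow> impartial G'"
  by (metis impartial.cases options_impartial)

lemma impartial_nimber [simp]: "impartial (nimber m)"
  by (induction m rule: less_induct) (rule impartialI, auto intro: fset_eqI)

lemma impartial_add: "impartial G \<Longrightarrow> impartial H \<Longrightarrow> impartial (G + H)"
proof (induction "size G + size H" arbitrary: G H rule: less_induct)
  case less
  show ?case
  proof (rule impartialI)
    show "options Left (G + H) = options Right (G + H)"
      using less.prems by (simp add: options_add options_impartial [of _ Right])
  next
    have 1: "impartial (G' + H)" if "G' |\<in>| options Left G" for G'
      using less size_option [OF that] impartial_option [OF less.prems(1) that] by simp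
    have 2: "impartial (G + H')" if "H' |\<in>| options Left H" for H'
      using less size_option [OF that] impartial_option [OF less.prems(2) that] by simp
    fix X assume "X |\<in>| options Left (G + H)"
    then show "impartial X"
      using 1 2 by (auto simp: mem_options_add)
  qed
qed

text \<open>
  The Sprague--Grundy theorem: the value is \<open>*c\<close> for the least \<open>c\<close> that is not among the values of
  the options. In \<open>G + *c\<close>, a move to a smaller nimber is answered by the option of \<open>G\<close> with that
  value, and a move in \<open>G\<close> leaves two different nimbers.
\<close>

lemma impartial_value_nimber: "impartial G \<Longrightarrow> \<exists>c. G \<simeq> nimber c"
proof (induction "size G" arbitrary: G rule: less_induct)
  case less
  have "\<exists>c. X \<simeq> nimber c" if "X |\<in>| options Left G" for X
    using less that size_option impartial_option [OF less.prems, of X Left] by simp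
  then obtain g where g: "\<And>X. X |\<in>| options Left G \<Longrightarrow> X \<simeq> nimber (g X)"
    by metis
  define S where "S = g ` fset (options Left G)"
  have "finite S"
    by (simp add: S_def)
  define c where "c = (LEAST c. c \<notin> S)"
  have c: "c \<notin> S"
    unfolding c_def using \<open>finite S\<close> by (metis LeastI ex_new_if_finite infinite_UNIV_nat)
  have below_c: "d \<in> S" if "d < c" for d
    using that not_less_Least unfolding c_def by blast
  have "wins_second p (G + nimber c)" for p
  proof (rule wins_second_addI)
    fix G' assume "G' |\<in>| options (opponent p) G"
    then have G': "G' |\<in>| options Left G"
      using options_impartial [OF less.prems, of "opponent p"] by simp
    then have "g G' \<noteq> c"
      using c by (auto simp: S_def)
    then show "wins_moving_first p (G' + nimber c)"
      using wins_first_nimber_pair value_eq_wins [OF value_eq_add [OF g [OF G']]] by blast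
  next
    fix H' assume "H' |\<in>| options (opponent p) (nimber c)"
    then obtain d where d: "d < c" "H' = nimber d"
      by auto
    then obtain G' where G': "G' |\<in>| options Left G" "g G' = d"
      using below_c by (fastforce simp: S_def)
    then have "is_zero (G' + nimber d)"
      using g value_eq_is_zero [OF value_eq_add] is_zero_nimber_double by blast
    then show "wins_moving_first p (G + H')"
      using G' d options_impartial [OF less.prems, of p]
      by (intro wins_first_addI1 [of G']) (auto simp: is_zero_def)
  qed
  then have "is_zero (G + nimber c)"
    by (rule is_zeroI)
  then have "G \<simeq> nimber c"
    using value_eqI is_zero_nimber_double by blast
  then show ?case ..
qed

text \<open>
  Injectivity is all that far stars require of nim addition: a property of all but finitely many
  nimbers then still holds for all but finitely many of them after adding \<open>*c\<close>.
\<close>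

lemma nimber_shift:
  obtains g where "inj g" "\<And>m. nimber c + nimber m \<simeq> nimber (g m)"
proof -
  obtain g where g: "\<And>m. nimber c + nimber m \<simeq> nimber (g m)"
    using impartial_value_nimber [OF impartial_add [OF impartial_nimber impartial_nimber]] by metis
  have "inj g"
  proof (rule injI)
    fix x y assume "g x = g y"
    then have "nimber c + nimber x \<simeq> nimber c + nimber y"
      using g value_eq_sym value_eq_trans by metis
    then have "nimber c + nimber x + nimber c \<simeq> nimber c + nimber y + nimber c"
      by (rule value_eq_add)
    moreover have "nimber c + nimber z + nimber c \<simeq> nimber z" for z
      using value_eq_add_zero [OF is_zero_nimber_double [of c], of "nimber z"]
      by (simp add: ac_simps)
    ultimately have "nimber x \<simeq> nimber y"
      using value_eq_sym value_eq_trans by metis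
    then show "x = y"
      by (simp add: value_eq_nimber_iff)
  qed
  with g that show thesis
    by blast
qed


section \<open>Independence of the choice of the far star\<close>

lemma birthday_option: "X |\<in>| options p G \<Longrightarrow> birthday X < birthday G"
proof -
  assume X: "X |\<in>| options p G"
  obtain L R where G: "G = Game L R"
    by (cases G)
  have "Suc (birthday X) |\<in>| finsert 0 (Suc |`| (birthday |`| L |\<union>| birthday |`| R))"
    using X unfolding G by (cases p) (auto simp: options.simps)
  then have "Suc (birthday X) \<le> birthday G"
    unfolding G birthday.simps by (rule fMax_ge)
  then show ?thesis
    by simp
qed

text \<open>
  If a game \<open>Z\<close> born before day \<open>m\<close> had the value \<open>*m\<close>, then, after Right has moved from
  \<open>Z + *m\<close> to \<open>Z + *(m - 1)\<close>, Left would have to answer in \<open>Z\<close>, say by \<open>Z'\<close>. But \<open>Z'\<close> is born even earlier,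
  so \<open>*(m - 1)\<close> and \<open>*m\<close> are interchangeable next to it, and Left could have moved directly from
  \<open>Z + *m\<close> to the winning position \<open>Z' + *m\<close>. The hypothesis on the options of \<open>Z\<close> is the induction
  hypothesis of the independence result below, whose induction step in turn needs this lemma.
\<close>

lemma far_star_not_cancelled:
  assumes indep: "\<And>Z' p q m m'. Z' |\<in>| options q Z \<Longrightarrow> birthday Z' < m \<Longrightarrow> birthday Z' < m' \<Longrightarrow>
      wins_moving_first p (Z' + nimber m) \<longleftrightarrow> wins_moving_first p (Z' + nimber m')"
    and "birthday Z < m"
  shows "\<not> is_zero (Z + nimber m)"
proof
  assume zero: "is_zero (Z + nimber m)"
  obtain k where k: "m = Suc k"
    using assms(2) by (cases m) auto
  have first: "wins_moving_first p (Z + nimber j)" if "j < m" for p j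
  proof (rule ccontr)
    assume "\<not> wins_moving_first p (Z + nimber j)"
    then have "wins_moving_first (opponent p) (Z + nimber m)"
      using that by (intro wins_first_addI2 [of "nimber j"]) auto
    then show False
      using zero by (simp add: is_zero_def)
  qed
  have "wins_moving_first Left (Z + nimber k)"
    using first k by simp
  then show False
  proof (cases rule: wins_first_add_cases)
    case (left Z')
    have "wins_second Left (Z' + nimber m)"
      using left indep [of Z' Left m k] birthday_option [OF left(1)] assms(2) k by simp
    then have "wins_moving_first Left (Z + nimber m)"
      using left(1) by (intro wins_first_addI1)
    then show False
      using zero by (simp add: is_zero_def)
  next
    case (right H')
    then obtain j where "j < k" "H' = nimber j"
      by auto
    then show False
      using right first [of j Right] k by auto
  qed
qed

text \<open>
  Of two far stars \<open>*m\<close> and \<open>*k\<close> with \<open>m < k\<close>, the larger one has the additional moves to \<open>*j\<close> with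
  \<open>m \<le> j < k\<close>. If such a move wins for a player, then that player also wins \<open>Z + *m\<close> moving second;
  as \<open>Z + *m\<close> is not zero, some player wins it moving first, and this must be the same one.
\<close>

lemma far_star_independent:
  "birthday Z < m \<Longrightarrow> birthday Z < m' \<Longrightarrow>
     wins_moving_first p (Z + nimber m) \<longleftrightarrow> wins_moving_first p (Z + nimber m')"
proof (induction "size Z" arbitrary: Z p m m' rule: less_induct)
  case less
  have IH: "wins_moving_first p (Z' + nimber m) \<longleftrightarrow> wins_moving_first p (Z' + nimber m')"
    if "Z' |\<in>| options q Z" "birthday Z' < m" "birthday Z' < m'" for Z' p q m m'
    using less.hyps that size_option by blast
  have not_zero: "\<not> is_zero (Z + nimber m)" if "birthday Z < m" for m
    using far_star_not_cancelled IH that by blast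
  have *: "\<forall>p. wins_moving_first p (Z + nimber m) \<longleftrightarrow> wins_moving_first p (Z + nimber k)"
    if "birthday Z < m" "m < k" for m k
    using that(2)
  proof (induction k rule: less_induct)
    case (less k)
    show ?case
    proof (intro allI iffI)
      fix p assume "wins_moving_first p (Z + nimber m)"
      then show "wins_moving_first p (Z + nimber k)"
      proof (cases rule: wins_first_add_cases)
        case (left Z')
        then show ?thesis
          using IH [OF left(1), of m k] birthday_option [OF left(1)] that(1) less.prems
          by (intro wins_first_addI1 [of Z']) auto
      next
        case (right H')
        then show ?thesis
          using less.prems by (intro wins_first_addI2 [of H']) (auto intro: less_trans)
      qed
    next
      fix p assume "wins_moving_first p (Z + nimber k)"
      then show "wins_moving_first p (Z + nimber m)"
      proof (cases rule: wins_first_add_cases)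
        case (left Z')
        then show ?thesis
          using IH [OF left(1), of m k] birthday_option [OF left(1)] that(1) less.prems
          by (intro wins_first_addI1 [of Z']) auto
      next
        case (right H')
        then obtain j where j: "j < k" "H' = nimber j"
          by auto
        show ?thesis
        proof (cases "j < m")
          case True
          then show ?thesis
            using right j by (intro wins_first_addI2 [of H']) auto
        next
          case False
          then have "wins_second p (Z + nimber m)"
            using less.IH [OF j(1)] right(2) j(2) by (cases "j = m") auto
          then show ?thesis
            using not_zero [OF that(1)] unfolding is_zero_def
            by (cases p) (metis opponent.simps player.exhaust)+
        qed
      qed
    qed
  qed
  consider "m < m'" | "m = m'" | "m' < m"
    by linarith
  then show ?case
  proof cases
    case 1
    then show ?thesis
      using * less.prems by blast
  next
    case 2
    then show ?thesis
      by simp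
  next
    case 3
    then show ?thesis
      using * less.prems by blast
  qed
qed


section \<open>Domination of every far star\<close>

text \<open>
  Demanding a win against all but finitely many nimbers, rather than against those above the
  birthday, keeps birthdays out of the strategies: a shift by a nimber is harmless, and finitely
  many bounds need not be tracked.
\<close>

definition far_wins :: "player \<Rightarrow> game \<Rightarrow> bool" where
  "far_wins p Z \<longleftrightarrow> (MOST m. wins_second p (Z + nimber m))"

lemma far_wins_iff:
  assumes "birthday Z < m"
  shows "wins_second p (Z + nimber m) \<longleftrightarrow> far_wins p Z"
proof
  assume "wins_second p (Z + nimber m)"
  then have "wins_second p (Z + nimber m')" if "m' > birthday Z" for m'
    using far_star_independent assms that by blast
  then show "far_wins p Z"
    unfolding far_wins_def MOST_nat by blast
next
  assume "far_wins p Z"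
  then obtain M where M: "\<And>m'. M < m' \<Longrightarrow> wins_second p (Z + nimber m')"
    unfolding far_wins_def MOST_nat by blast
  have "wins_second p (Z + nimber (Suc (max M (birthday Z))))"
    by (rule M) simp
  then show "wins_second p (Z + nimber m)"
    using far_star_independent [of Z m "Suc (max M (birthday Z))"] assms by simp
qed

lemma far_wins_cong:
  assumes "Z \<simeq> Z'"
  shows "far_wins p Z \<longleftrightarrow> far_wins p Z'"
  unfolding far_wins_def by (simp add: value_eq_wins [OF value_eq_add [OF assms]])

lemma value_eq_double_nimber: "nimber c + nimber c + G \<simeq> G"
  by (rule value_eq_add_zero [OF is_zero_nimber_double])

lemma far_wins_add_nimber:
  assumes "far_wins p Z"
  shows "far_wins p (Z + nimber c)"
proof -
  obtain g where g: "inj g" "\<And>m. nimber c + nimber m \<simeq> nimber (g m)"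
    using nimber_shift [of c] by blast
  have "wins_second p (Z + nimber c + nimber m) \<longleftrightarrow> wins_second p (Z + nimber (g m))" for m
    using value_eq_wins [OF value_eq_add [OF g(2) [of m], of Z]] by (simp add: ac_simps)
  then show ?thesis
    using MOST_inj [OF assms [unfolded far_wins_def] g(1)] by (simp add: far_wins_def)
qed

lemma far_wins_add_nimber_iff: "far_wins p (Z + nimber c) \<longleftrightarrow> far_wins p Z"
proof
  assume "far_wins p (Z + nimber c)"
  then have "far_wins p (Z + nimber c + nimber c)"
    by (rule far_wins_add_nimber)
  then show "far_wins p Z"
    using far_wins_cong [OF value_eq_double_nimber [of c Z]] by (simp add: ac_simps)
qed (rule far_wins_add_nimber)

lemma far_wins_uminus: "far_wins p (- Z) \<longleftrightarrow> far_wins (opponent p) Z"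
proof -
  have "- Z + nimber m = - (Z + nimber m)" for m
    by (simp add: uminus_add)
  then show ?thesis
    by (simp add: far_wins_def wins_first_uminus)
qed

lemma far_wins_wins_second_add:
  assumes "far_wins p U" "far_wins p Z"
  shows "wins_second p (U + Z)"
proof -
  obtain m where "wins_second p (U + nimber m)" "wins_second p (Z + nimber m)"
    using MOST_conjI [OF assms [unfolded far_wins_def]] unfolding MOST_nat by blast
  then have "wins_second p ((U + nimber m) + (Z + nimber m))"
    by (rule wins_second_add)
  then show ?thesis
    using value_eq_wins [OF value_eq_double_nimber [of m "U + Z"]] by (simp add: ac_simps)
qed

text \<open>
  After each move of the opponent in \<open>Z\<close> the star is still far. After a move of the opponent in
  the star it is an arbitrary nimber, of which nothing is known. The two lemmas that follow give the
  two ways to deal with the first situation: to answer in \<open>Z\<close>, or to cash in the star.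
\<close>

lemma far_winsI:
  assumes "\<And>Z'. Z' |\<in>| options (opponent p) Z \<Longrightarrow> MOST m. wins_moving_first p (Z' + nimber m)"
    and "\<And>j. wins_moving_first p (Z + nimber j)"
  shows "far_wins p Z"
proof -
  have "MOST m. \<forall>Z' \<in> fset (options (opponent p) Z). wins_moving_first p (Z' + nimber m)"
    using assms(1) by (intro eventually_ball_finite) auto
  then show ?thesis
    unfolding far_wins_def
  proof (rule MOST_mono)
    fix m assume *: "\<forall>Z' \<in> fset (options (opponent p) Z). wins_moving_first p (Z' + nimber m)"
    show "wins_second p (Z + nimber m)"
      using * assms(2) by (intro wins_second_addI) auto
  qed
qed

lemma respond_far_wins:
  assumes "Z' |\<in>| options p Z" "far_wins p Z'"
  shows "MOST m. wins_moving_first p (Z + nimber m)"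
  using assms(2) unfolding far_wins_def
  by (rule MOST_mono) (rule wins_first_addI1 [OF assms(1)])

lemma respond_star:
  assumes "wins_second p (Z + nimber j)"
  shows "MOST m. wins_moving_first p (Z + nimber m)"
proof -
  have "wins_moving_first p (Z + nimber m)" if "j < m" for m
    using assms that by (intro wins_first_addI2 [of "nimber j"]) auto
  then show ?thesis
    unfolding MOST_nat by blast
qed

text \<open>
  Conversely, a winning answer against one star above all birthdays involved is of one of these two
  kinds, and independence makes an answer within the game good for all far stars at once.
\<close>

lemma far_wins_response:
  assumes "far_wins p Z" "Z' |\<in>| options (opponent p) Z"
  obtains (option) Z'' where "Z'' |\<in>| options p Z'" "far_wins p Z''"
  | (star) j where "wins_second p (Z' + nimber j)"
proof -
  define m where "m = Suc (birthday Z)"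
  have m: "birthday Z < m" "birthday Z' < m"
    using birthday_option [OF assms(2)] by (simp_all add: m_def)
  have "wins_second p (Z + nimber m)"
    using far_wins_iff [OF m(1)] assms(1) by simp
  then have "wins_moving_first p (Z' + nimber m)"
    using wins_first_addI1 [OF assms(2), of "nimber m"] by auto
  then show thesis
  proof (cases rule: wins_first_add_cases)
    case (left Z'')
    then show ?thesis
      using that(1) far_wins_iff [of Z'' m] birthday_option [OF left(1)] m by simp
  next
    case (right H')
    then show ?thesis
      using that(2) by auto
  qed
qed

text \<open>The arrow that favours the given player.\<close>

fun arrow :: "player \<Rightarrow> game" where
  "arrow Left = up"
| "arrow Right = down"

lemma options_arrow [simp]:
  "options p (arrow p) = {|0|}"
  "options (opponent p) (arrow p) = {|nimber 1|}"
  "options p (arrow (opponent p)) = {|nimber 1|}"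
  by (cases p; simp add: options.simps up_def down_eq)+

lemma arrow_opponent: "arrow (opponent p) = - arrow p"
  by (cases p) (simp_all add: down_def)

text \<open>
  The player keeps both summands at least a far star as long as possible. The opponent's arrow is a
  reserve: when the winning answer in one summand consists in moving its star to \<open>*j\<close>, or when the
  opponent has used up the real star, the player turns the arrow into \<open>*\<close>. Then the nimbers on the
  table together with the star of the other summand supply whatever star is wanted. If the
  opponent removes the arrow, the player removes the star, and the two imaginary stars next to
  \<open>U\<close> and \<open>Z\<close> cancel.
\<close>

lemma far_wins_add_arrow:
  "far_wins p U \<Longrightarrow> far_wins p Z \<Longrightarrow> far_wins p (U + Z + arrow (opponent p))"
proof (induction "size U + size Z" arbitrary: U Z rule: less_induct)
  case less
  let ?d = "arrow (opponent p)"
  \<comment> \<open>Stated for one summand, and used for both because the situation is symmetric.\<close>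
  have answer: "MOST m. wins_moving_first p (U' + Z + ?d + nimber m)"
    if U: "far_wins p U" "far_wins p Z" "U' |\<in>| options (opponent p) U"
      and IH: "\<And>U''. size U'' < size U \<Longrightarrow> far_wins p U'' \<Longrightarrow> far_wins p (U'' + Z + ?d)"
    for U U' Z
    using U(1,3)
  proof (cases rule: far_wins_response)
    case (option U'')
    then have "size U'' < size U"
      using size_option [OF U(3)] size_option [OF option(1)] by simp
    then have "far_wins p (U'' + Z + ?d)"
      using IH option(2) by blast
    moreover have "U'' + Z + ?d |\<in>| options p (U' + Z + ?d)"
      using option(1) by (auto simp: mem_options_add)
    ultimately show ?thesis
      by (intro respond_far_wins)
  next
    case (star j)
    \<comment> \<open>Two copies of \<open>*j\<close> are inserted: one completes the winning answer in \<open>U'\<close>, the other is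
      absorbed by the far star next to \<open>Z\<close>.\<close>
    have "far_wins p (Z + nimber 1 + nimber j)"
      using U(2) by (intro far_wins_add_nimber)
    then have "far_wins p (U' + nimber j + (Z + nimber 1 + nimber j))"
      unfolding far_wins_def
      by (rule MOST_mono) (use wins_second_add [OF star] in \<open>simp add: add.assoc\<close>)
    then have "far_wins p (U' + Z + nimber 1)"
      using far_wins_cong [OF value_eq_double_nimber [of j "U' + Z + nimber 1"]]
      by (simp add: ac_simps)
    moreover have "U' + Z + nimber 1 |\<in>| options p (U' + Z + ?d)"
      by (auto simp: mem_options_add)
    ultimately show ?thesis
      by (intro respond_far_wins)
  qed
  show ?case
  proof (rule far_winsI)
    fix Y assume "Y |\<in>| options (opponent p) (U + Z + ?d)"
    then consider U' where "U' |\<in>| options (opponent p) U" "Y = U' + Z + ?d"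
      | Z' where "Z' |\<in>| options (opponent p) Z" "Y = U + Z' + ?d"
      | "Y = U + Z"
      by (auto simp: mem_options_add)
    then show "MOST m. wins_moving_first p (Y + nimber m)"
    proof cases
      case 1
      have "far_wins p (U'' + Z + ?d)" if "size U'' < size U" "far_wins p U''" for U''
        using less that by simp
      then show ?thesis
        using answer [OF less.prems 1(1)] 1(2) by blast
    next
      case 2
      have "far_wins p (Z'' + U + ?d)" if "size Z'' < size Z" "far_wins p Z''" for Z''
        using less that by (simp add: add.commute)
      then show ?thesis
        using answer [OF less.prems(2,1) 2(1)] 2(2) by (simp add: add.commute)
    next
      case 3
      then show ?thesis
        using far_wins_wins_second_add [OF less.prems]
        by (intro respond_star [of p _ 0]) (simp add: nimber_0)
    qed
  next
    fix j
    have "wins_second p (U + (Z + nimber 1 + nimber j))"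
      using less.prems by (intro far_wins_wins_second_add far_wins_add_nimber)
    moreover have "U + Z + nimber 1 + nimber j |\<in>| options p (U + Z + ?d + nimber j)"
      by (auto simp: mem_options_add)
    ultimately show "wins_moving_first p (U + Z + ?d + nimber j)"
      by (intro wins_firstI) (simp_all add: ac_simps)
  qed
qed

text \<open>
  The hypothesis on \<open>G - H\<close> replaces \<open>H\<close> by \<open>G\<close> in any context: adding it to \<open>H + X\<close> costs one arrow
  by the previous lemma, which is just the arrow that it contains.
\<close>

lemma far_wins_transfer:
  assumes "far_wins p (G + - H + arrow p)" "far_wins p (H + X)"
  shows "far_wins p (G + X)"
proof -
  have "far_wins p ((G + - H + arrow p) + (H + X) + - arrow p)"
    using far_wins_add_arrow [OF assms] by (simp add: arrow_opponent)
  moreover have "(H + - H) + (arrow p + - arrow p) + (G + X) \<simeq> G + X"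
    by (intro value_eq_add_zero is_zero_add is_zero_add_uminus)
  ultimately show ?thesis
    using far_wins_cong by (simp add: ac_simps)
qed

lemma far_star_equiv_if_far_wins:
  assumes "\<And>p X. far_wins p (G + X) \<longleftrightarrow> far_wins p (H + X)"
  shows "far_star_equiv G H"
  unfolding far_star_equiv_def birthday_nimber
proof (intro allI impI)
  fix X m assume m: "birthday (G + X) < m \<and> birthday (H + X) < m"
  have "wins_moving_first p (G + X + nimber m) \<longleftrightarrow> wins_moving_first p (H + X + nimber m)" for p
    using far_wins_iff [of "G + X" m "opponent p"] far_wins_iff [of "H + X" m "opponent p"]
      m assms [of "opponent p" X] by auto
  then show "outcome (G + X + nimber m) = outcome (H + X + nimber m)"
    by (simp add: outcome_def)
qed

text \<open>
  Negation exchanges the two halves of this criterion, so that the hypotheses let both players pass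
  from \<open>G\<close> to \<open>H\<close> and back. They say that \<open>G - H\<close> lies between down plus far star and up plus far
  star.
\<close>

lemma far_star_equivI:
  assumes "far_wins Left (G + - H + up)" "far_wins Right (G + - H + down)"
  shows "far_star_equiv G H"
proof (rule far_star_equiv_if_far_wins)
  fix p X
  have GH: "far_wins p (G + - H + arrow p)" for p
    using assms by (cases p) simp_all
  have "far_wins p (- (G + - H + arrow (opponent p)))"
    using GH [of "opponent p"] by (simp add: far_wins_uminus)
  then have HG: "far_wins p (H + - G + arrow p)"
    by (simp add: uminus_add arrow_opponent ac_simps)
  show "far_wins p (G + X) \<longleftrightarrow> far_wins p (H + X)"
    using far_wins_transfer [OF GH] far_wins_transfer [OF HG] by blast
qed

lemma impartial_far_star_equiv_zero:
  assumes "impartial G"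
  shows "far_star_equiv G 0"
proof (rule far_star_equiv_if_far_wins)
  fix p X
  obtain c where "G \<simeq> nimber c"
    using impartial_value_nimber [OF assms] ..
  then have "far_wins p (G + X) \<longleftrightarrow> far_wins p (X + nimber c)"
    using far_wins_cong [OF value_eq_add] by (metis add.commute)
  then show "far_wins p (G + X) \<longleftrightarrow> far_wins p (0 + X)"
    by (simp add: far_wins_add_nimber_iff)
qed


section \<open>Multiples of up\<close>

lemma copies_0 [simp]: "copies 0 G = 0"
  by (simp add: copies_def)

lemma copies_Suc: "copies (Suc k) G = G + copies k G"
  by (simp add: copies_def)

lemma options_up [simp]: "options Left up = {|0|}" "options Right up = {|nimber 1|}"
  by (simp_all add: options.simps up_def)

lemma options_copies_up:
  "options Left (copies (Suc q) up) = {|copies q up|}"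
  "options Right (copies (Suc q) up) = {|nimber 1 + copies q up|}"
proof (induction q)
  case 0
  case 1 show ?case by (simp add: copies_Suc options_add)
  case 2 show ?case by (simp add: copies_Suc options_add)
next
  case (Suc q)
  have "copies (Suc (Suc q)) up = up + copies (Suc q) up"
    by (rule copies_Suc)
  then have *: "options p (copies (Suc (Suc q)) up) = (\<lambda>X. X + copies (Suc q) up) |`| options p up
      |\<union>| (\<lambda>Y. up + Y) |`| options p (copies (Suc q) up)" for p
    by (simp only: options_add)
  case 1 show ?case
    unfolding * Suc by (simp add: copies_Suc)
  case 2 show ?case
    unfolding * Suc by (simp add: copies_Suc ac_simps)
qed

lemma uminus_copies: "- copies k G = copies k (- G)"
  by (induction k) (auto simp: copies_Suc uminus_add, simp add: zero_game_def)

lemma wins_second_arrow: "wins_second p (arrow p)"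
proof -
  have "wins_moving_first p (nimber 1)"
    by (rule wins_firstI [of "nimber 0"]) (auto simp: nimber_0)
  then show ?thesis
    by (subst wins_second_iff) simp
qed

lemma wins_second_copies_up: "wins_second Left (copies q up)"
proof (induction q)
  case (Suc q)
  then show ?case
    using wins_second_add [OF wins_second_arrow [of Left]] by (simp add: copies_Suc)
qed simp

lemma wins_first_arrow_nimber: "wins_moving_first p (arrow p + nimber d)"
proof (cases "d = 0")
  case True
  then show ?thesis
    by (intro wins_first_addI1 [of 0]) (auto simp: nimber_0)
next
  case False
  then show ?thesis
    using wins_second_arrow [of p]
    by (intro wins_first_addI2 [of 0]) (auto intro!: exI [of _ 0] simp: nimber_0)
qed

lemma wins_first_impartial_arrow:
  assumes "impartial G"
  shows "wins_moving_first p (G + arrow p)"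
proof -
  obtain d where "G \<simeq> nimber d"
    using impartial_value_nimber [OF assms] ..
  then show ?thesis
    using value_eq_wins [OF value_eq_add] wins_first_arrow_nimber by (metis add.commute)
qed

lemma impartial_cancel:
  assumes "impartial G"
  obtains c where "is_zero (G + nimber c)"
proof -
  obtain c where "G \<simeq> nimber c"
    using impartial_value_nimber [OF assms] ..
  then have "is_zero (G + nimber c)"
    using value_eq_is_zero [OF value_eq_add] is_zero_nimber_double by blast
  then show thesis
    by (rule that)
qed


section \<open>Full Support\<close>

lemma mem_options_full_support:
  "X |\<in>| options Left (full_support n a b) \<longleftrightarrow>
     (\<exists>i. 1 \<le> i \<and> i \<le> a \<and> i \<le> n \<and> X = full_support (n - i) a b)"
  "X |\<in>| options Right (full_support n a b) \<longleftrightarrow>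
     (\<exists>j. 1 \<le> j \<and> j \<le> b \<and> j \<le> n \<and> X = full_support (n - j) a b)"
proof -
  have "options Left (full_support n a b) =
      (\<lambda>i. full_support (n - i) a b) |`| ffilter (\<lambda>i. i \<le> n) (fset_of_list [1..<Suc a])"
    "options Right (full_support n a b) =
      (\<lambda>j. full_support (n - j) a b) |`| ffilter (\<lambda>j. j \<le> n) (fset_of_list [1..<Suc b])"
    by (subst full_support.simps, simp only: options.simps game.sel)+
  then show "X |\<in>| options Left (full_support n a b) \<longleftrightarrow>
     (\<exists>i. 1 \<le> i \<and> i \<le> a \<and> i \<le> n \<and> X = full_support (n - i) a b)"
    "X |\<in>| options Right (full_support n a b) \<longleftrightarrow>
     (\<exists>j. 1 \<le> j \<and> j \<le> b \<and> j \<le> n \<and> X = full_support (n - j) a b)"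
    by (auto simp: fset_of_list_elem less_Suc_eq_le simp del: upt_Suc)
qed

lemma full_support_0 [simp]: "full_support 0 a b = 0"
proof (rule game_eqI)
  fix p show "options p (full_support 0 a b) = options p 0"
    by (cases p; intro fset_eqI) (simp_all add: mem_options_full_support)
qed

lemma impartial_full_support_same: "impartial (full_support n a a)"
proof (induction n rule: less_induct)
  case (less n)
  show ?case
  proof (rule impartialI)
    show "options Left (full_support n a a) = options Right (full_support n a a)"
      by (rule fset_eqI) (simp add: mem_options_full_support)
  next
    fix G' assume "G' |\<in>| options Left (full_support n a a)"
    then show "impartial G'"
      using less by (auto simp: mem_options_full_support)
  qed
qed

lemma impartial_full_support_small:
  assumes "n \<le> a" "n \<le> b"
  shows "impartial (full_support n a b)"
  using assms
proof (induction n rule: less_induct)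
  case (less n)
  show ?case
  proof (rule impartialI)
    have "1 \<le> i \<and> i \<le> a \<and> i \<le> n \<and> P \<longleftrightarrow> 1 \<le> i \<and> i \<le> b \<and> i \<le> n \<and> P" for i P
      using less.prems by auto
    then show "options Left (full_support n a b) = options Right (full_support n a b)"
      by (intro fset_eqI) (simp only: mem_options_full_support)
  next
    fix G' assume "G' |\<in>| options Left (full_support n a b)"
    then show "impartial G'"
      using less by (auto simp: mem_options_full_support)
  qed
qed

context
  fixes a b :: nat
  assumes a_pos: "0 < a" and a_le_b: "a \<le> b"
begin

abbreviation (input) F :: "nat \<Rightarrow> game" where
  "F n \<equiv> full_support n a b"

abbreviation (input) U :: "nat \<Rightarrow> game" where
  "U q \<equiv> copies q up"

lemma impartial_F: "n \<le> a \<Longrightarrow> impartial (F n)"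
  using a_le_b impartial_full_support_small by simp

text \<open>
  A heap of at most \<open>q a\<close> pebbles with \<open>q\<close> ups is one up ahead for Left, which is worth the win when
  moving first, whatever nimber is added; being two ups ahead wins even moving second. The two claims
  support each other: removing \<open>a\<close> pebbles turns one up ahead into two, and any move of Right
  loses at most one up.
\<close>

lemma left_wins_ahead:
  "(1 \<le> q \<longrightarrow> n \<le> q * a \<longrightarrow> (\<forall>j. wins_moving_first Left (F n + U q + nimber j))) \<and>
   (2 \<le> q \<longrightarrow> n \<le> (q - 1) * a \<longrightarrow> (\<forall>j. wins_second Left (F n + U q + nimber j)))"
proof (induction "n + q" arbitrary: n q rule: less_induct)
  case less
  have IH1: "wins_moving_first Left (F n' + U q' + nimber j)"
    if "n' + q' < n + q" "1 \<le> q'" "n' \<le> q' * a" for n' q' j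
    using less.hyps [OF that(1)] that(2-) by blast
  have IH2: "wins_second Left (F n' + U q' + nimber j)"
    if "n' + q' < n + q" "2 \<le> q'" "n' \<le> (q' - 1) * a" for n' q' j
    using less.hyps [OF that(1)] that(2-) by blast
  have first: "wins_moving_first Left (F n + U q + nimber j)" if q: "1 \<le> q" "n \<le> q * a" for j
  proof -
    obtain r where r: "q = Suc r"
      using q(1) by (cases q) auto
    \<comment> \<open>Left either spends an up, or empties the star, or finishes off an impartial heap, or removes
      \<open>a\<close> pebbles to get one up further ahead.\<close>
    consider "n = 0" "j = 0" | "n = 0" "0 < j" | "0 < n" "q = 1" | "0 < n" "2 \<le> q"
      using q(1) by linarith
    then show ?thesis
    proof cases
      case 1
      have "U r |\<in>| options Left (U q)"
        by (simp add: r options_copies_up)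
      then show ?thesis
        using 1 wins_second_copies_up [of r] by (simp add: nimber_0 wins_firstI)
    next
      case 2
      then show ?thesis
        using wins_second_copies_up [of q]
        by (intro wins_first_addI2 [of 0]) (auto intro!: exI [of _ 0] simp: nimber_0)
    next
      case 3
      then have "impartial (F n + nimber j)"
        using q(2) by (intro impartial_add impartial_F) auto
      then have "wins_moving_first Left (F n + nimber j + arrow Left)"
        by (rule wins_first_impartial_arrow)
      then show ?thesis
        using 3 by (simp add: copies_Suc [of 0, simplified] ac_simps)
    next
      case 4
      define i where "i = min n a"
      have "F (n - i) |\<in>| options Left (F n)"
        using 4(1) a_pos by (auto simp: mem_options_full_support i_def intro!: exI [of _ "min n a"])
      moreover have "n - i \<le> (q - 1) * a"
        using q by (auto simp: i_def r)
      then have "wins_second Left (F (n - i) + U q + nimber j)"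
        using 4 a_pos by (intro IH2) (auto simp: i_def)
      ultimately show ?thesis
        unfolding add.assoc by (rule wins_first_addI1)
    qed
  qed
  have second: "wins_second Left (F n + U q + nimber j)" if q: "2 \<le> q" "n \<le> (q - 1) * a" for j
  proof -
    obtain r where r: "q = Suc r" "1 \<le> r"
      using q(1) by (cases q) auto
    show ?thesis
    proof (rule wins_second_addI)
      fix Y assume "Y |\<in>| options (opponent Left) (F n + U q)"
      then consider i where "1 \<le> i" "i \<le> n" "Y = F (n - i) + U q" | "Y = F n + (nimber 1 + U r)"
        by (auto simp: mem_options_add mem_options_full_support r options_copies_up)
      then show "wins_moving_first Left (Y + nimber j)"
      proof cases
        case 1
        then show ?thesis
          using q r by (auto intro!: IH1)
      next
        case 2
        obtain d where d: "nimber 1 + nimber j \<simeq> nimber d"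
          using impartial_value_nimber [OF impartial_add] impartial_nimber by blast
        have "wins_moving_first Left (F n + U r + nimber d)"
          using q r by (intro IH1) auto
        then show ?thesis
          using value_eq_wins [OF value_eq_add [OF d, of "F n + U r"]] 2 by (simp add: ac_simps)
      qed
    next
      fix H' assume "H' |\<in>| options (opponent Left) (nimber j)"
      then show "wins_moving_first Left (F n + U q + H')"
        using q r first by fastforce
    qed
  qed
  show ?case
    using first second by blast
qed

text \<open>
  Next to a far star, being one up ahead is enough to win moving second. If Right turns an up into
  a star, Left removes \<open>a\<close> pebbles, and the new star is absorbed; if no pebble is left, or if
  it was the last up and hence at most \<open>a\<close> pebbles are left, Left uses the far star to cancel the
  nimber formed by the heap and the new star. If Right removes pebbles, the lead has not shrunk, and
  Left just removes one more pebble or, if there is none, the far star.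
\<close>

lemma left_far_wins:
  "1 \<le> q \<Longrightarrow> n \<le> q * a \<Longrightarrow> far_wins Left (F n + U q)"
proof (induction "n + q" arbitrary: n q rule: less_induct)
  case less
  obtain r where r: "q = Suc r"
    using less.prems(1) by (cases q) auto
  show ?case
  proof (rule far_winsI)
    fix Y assume "Y |\<in>| options (opponent Left) (F n + U q)"
    then consider (heap) i where "0 < i" "i \<le> n" "Y = F (n - i) + U q"
      | (up) "Y = F n + (nimber 1 + U r)"
      by (auto simp: mem_options_add mem_options_full_support r options_copies_up Suc_le_eq)
    then show "MOST m. wins_moving_first Left (Y + nimber m)"
    proof cases
      case heap
      show ?thesis
      proof (cases "i = n")
        case True
        then show ?thesis
          using heap wins_second_copies_up [of q]
          by (intro respond_star [of _ _ 0]) (simp add: nimber_0)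
      next
        case False
        have "F (n - i - 1) |\<in>| options Left (F (n - i))"
          using heap False a_pos by (auto simp: mem_options_full_support intro!: exI [of _ 1])
        moreover have "far_wins Left (F (n - i - 1) + U q)"
          using heap False less by simp
        ultimately show ?thesis
          using heap by (intro respond_far_wins [of "F (n - i - 1) + U q"]) (auto simp: mem_options_add)
      qed
    next
      case up
      consider "n = 0" | "0 < n" "r = 0" | "0 < n" "0 < r"
        by (cases "n = 0"; cases "r = 0") auto
      then show ?thesis
      proof cases
        case 1
        have "wins_second Left (nimber 1 + nimber 1 + U r)"
          using value_eq_wins [OF value_eq_double_nimber [of 1 "U r"]] wins_second_copies_up [of r]
          by simp
        then show ?thesis
          using 1 up by (intro respond_star [of _ _ 1]) (simp add: ac_simps)
      next
        case 2
        then have "impartial (F n + nimber 1)"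
          using less.prems r by (intro impartial_add impartial_F) auto
        then obtain c where "is_zero (F n + nimber 1 + nimber c)"
          by (rule impartial_cancel)
        then show ?thesis
          using 2 up by (intro respond_star [of _ _ c]) (simp add: is_zero_def)
      next
        case 3
        define i where "i = min n a"
        have "F (n - i) |\<in>| options Left (F n)"
          using 3 a_pos by (auto simp: mem_options_full_support i_def intro!: exI [of _ "min n a"])
        moreover have "far_wins Left (F (n - i) + U r)"
          using less.prems 3 by (intro less.hyps) (auto simp: i_def r)
        then have "far_wins Left (F (n - i) + (nimber 1 + U r))"
          using far_wins_add_nimber [of Left "F (n - i) + U r" 1] by (simp add: ac_simps)
        ultimately show ?thesis
          using up by (intro respond_far_wins [of "F (n - i) + (nimber 1 + U r)"])
            (auto simp: mem_options_add)
      qed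
    qed
  next
    fix j show "wins_moving_first Left (F n + U q + nimber j)"
      using left_wins_ahead less.prems by blast
  qed
qed

context
  assumes a_less_b: "a < b"
begin

text \<open>
  From a heap of more than \<open>a\<close> pebbles Left cannot reach \<open>0\<close>. Right then either takes all, or, if
  more than \<open>b\<close> pebbles are left, takes one and leaves at least \<open>b > a\<close>. With \<open>a = b\<close> this last
  position could be one in which Left takes all.
\<close>

lemma right_wins_heap:
  "(1 \<le> n \<longrightarrow> wins_moving_first Right (F n)) \<and> (a < n \<longrightarrow> wins_second Right (F n))"
proof (induction n rule: less_induct)
  case (less n)
  have first: "wins_moving_first Right (F n)" if n: "1 \<le> n"
  proof (cases "n \<le> b")
    case True
    have "0 |\<in>| options Right (F n)"
      using n True by (auto simp: mem_options_full_support intro!: exI [of _ n])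
    then show ?thesis
      by (rule wins_firstI) simp
  next
    case False
    have "F (n - 1) |\<in>| options Right (F n)"
      using n a_less_b by (auto simp: mem_options_full_support intro!: exI [of _ 1])
    moreover have "wins_second Right (F (n - 1))"
      using less [of "n - 1"] False a_less_b by simp
    ultimately show ?thesis
      by (rule wins_firstI)
  qed
  moreover have "wins_second Right (F n)" if "a < n"
  proof (subst wins_second_iff, intro allI impI)
    fix Y assume "Y |\<in>| options (opponent Right) (F n)"
    then obtain i where "1 \<le> i" "i \<le> a" "Y = F (n - i)"
      by (auto simp: mem_options_full_support)
    then show "wins_moving_first Right Y"
      using less [of "n - i"] that by simp
  qed
  ultimately show ?case
    by blast
qed

text \<open>With a far star at hand, Right can neutralise any heap: by its own nimber, or by \<open>0\<close>.\<close>

lemma right_cancels_heap: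
  obtains c where "wins_second Right (F n + nimber c)"
proof (cases "n \<le> a")
  case True
  then show ?thesis
    using impartial_cancel [OF impartial_F] that by (metis is_zero_def)
next
  case False
  then show ?thesis
    using right_wins_heap [of n] that [of 0] by (simp add: nimber_0)
qed

text \<open>
  The mirror image of \<open>left_wins_ahead\<close>, in which the pebbles are worth one down for each full \<open>a\<close>.
  Here Right gains by turning an up into a star instead of removing pebbles, and the induction ends
  with a bare heap next to a nimber.
\<close>

lemma right_wins_ahead:
  "((r + 1) * a < n \<longrightarrow> (\<forall>j. wins_moving_first Right (F n + U r + nimber j))) \<and>
   ((r + 2) * a < n \<longrightarrow> (\<forall>j. wins_second Right (F n + U r + nimber j)))"
proof (induction "n + r" arbitrary: n r rule: less_induct)
  case less
  have IH1: "wins_moving_first Right (F n' + U r' + nimber j)"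
    if "n' + r' < n + r" "(r' + 1) * a < n'" for n' r' j
    using less.hyps [OF that(1)] that(2-) by blast
  have IH2: "wins_second Right (F n' + U r' + nimber j)"
    if "n' + r' < n + r" "(r' + 2) * a < n'" for n' r' j
    using less.hyps [OF that(1)] that(2-) by blast
  have first: "wins_moving_first Right (F n + U r + nimber j)" if n: "(r + 1) * a < n" for j
  proof (cases r)
    case 0
    show ?thesis
    proof (cases "j = 0")
      case True
      then show ?thesis
        using 0 n right_wins_heap [of n] by (simp add: nimber_0)
    next
      case False
      then show ?thesis
        using 0 n right_wins_heap [of n]
        by (intro wins_first_addI2 [of 0]) (auto intro!: exI [of _ 0] simp: nimber_0)
    qed
  next
    case (Suc s)
    obtain d where d: "nimber 1 + nimber j \<simeq> nimber d"
      using impartial_value_nimber [OF impartial_add] impartial_nimber by blast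
    have "wins_second Right (F n + U s + nimber d)"
      using n Suc by (intro IH2) auto
    then have "wins_second Right (F n + (nimber 1 + U s) + nimber j)"
      using value_eq_wins [OF value_eq_add [OF d, of "F n + U s"]] by (simp add: ac_simps)
    moreover have "F n + (nimber 1 + U s) |\<in>| options Right (F n + U r)"
      by (simp add: Suc mem_options_add options_copies_up)
    ultimately show ?thesis
      by (intro wins_first_addI1)
  qed
  have second: "wins_second Right (F n + U r + nimber j)" if n: "(r + 2) * a < n" for j
  proof (rule wins_second_addI)
    fix Y assume "Y |\<in>| options (opponent Right) (F n + U r)"
    then consider i where "1 \<le> i" "i \<le> a" "i \<le> n" "Y = F (n - i) + U r"
      | s where "r = Suc s" "Y = F n + U s"
      by (cases r) (auto simp: mem_options_add mem_options_full_support options_copies_up)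
    then show "wins_moving_first Right (Y + nimber j)"
    proof cases
      case 1
      then show ?thesis
        using n by (auto intro!: IH1)
    next
      case 2
      then show ?thesis
        using n by (auto intro!: IH1)
    qed
  next
    fix H' assume "H' |\<in>| options (opponent Right) (nimber j)"
    then show "wins_moving_first Right (F n + U r + H')"
      using n by (auto intro!: first)
  qed
  show ?case
    using first second by blast
qed

text \<open>
  If Left removes pebbles, Right turns an up into a star, which the far star absorbs, and so keeps
  his lead. If Left gives up an up, Right has gained and can afford to remove a single pebble.
  Without ups, he uses the far star to neutralise the heap.
\<close>

lemma right_far_wins:
  "(r + 1) * a < n \<Longrightarrow> far_wins Right (F n + U r)"
proof (induction r arbitrary: n)
  case 0
  show ?case
  proof (rule far_winsI)
    fix Y assume "Y |\<in>| options (opponent Right) (F n + U 0)"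
    then obtain i where "Y = F (n - i)"
      by (auto simp: mem_options_full_support)
    then show "MOST m. wins_moving_first Right (Y + nimber m)"
      using right_cancels_heap [of "n - i"] respond_star by blast
  next
    fix j show "wins_moving_first Right (F n + U 0 + nimber j)"
      using right_wins_ahead 0 by blast
  qed
next
  case (Suc s)
  show ?case
  proof (rule far_winsI)
    fix Y assume "Y |\<in>| options (opponent Right) (F n + U (Suc s))"
    then consider i where "i \<le> a" "Y = F (n - i) + U (Suc s)" | "Y = F n + U s"
      by (auto simp: mem_options_add mem_options_full_support options_copies_up)
    then show "MOST m. wins_moving_first Right (Y + nimber m)"
    proof cases
      case 1
      have "far_wins Right (F (n - i) + U s)"
        using Suc 1 by simp
      then have "far_wins Right (F (n - i) + (nimber 1 + U s))"
        using far_wins_add_nimber [of Right "F (n - i) + U s" 1] by (simp add: ac_simps)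
      then show ?thesis
        using 1 by (intro respond_far_wins [of "F (n - i) + (nimber 1 + U s)"])
          (auto simp: mem_options_add options_copies_up)
    next
      case 2
      have "F (n - 1) |\<in>| options Right (F n)"
        using Suc.prems a_less_b by (auto simp: mem_options_full_support intro!: exI [of _ 1])
      moreover have "far_wins Right (F (n - 1) + U s)"
        using Suc a_pos by simp
      ultimately show ?thesis
        using 2 by (intro respond_far_wins [of "F (n - 1) + U s"]) (auto simp: mem_options_add)
    qed
  next
    fix j show "wins_moving_first Right (F n + U (Suc s) + nimber j)"
      using right_wins_ahead Suc.prems by blast
  qed
qed

text \<open>
  The case of \<open>-1\<close> ups. Whatever Left does to the heap or the down, Right uses the far star to
  neutralise the rest, and the down that remains, if any, is at most \<open>0\<close>.
\<close>

lemma right_far_wins_down: "far_wins Right (F n + down)"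
proof (rule far_winsI)
  have down: "wins_second Right down"
    using wins_second_arrow [of Right] by simp
  fix Y assume "Y |\<in>| options (opponent Right) (F n + down)"
  then consider i where "Y = F (n - i) + down" | "Y = F n + nimber 1"
    using options_arrow(2) [of Right] by (auto simp: mem_options_add mem_options_full_support)
  then show "MOST m. wins_moving_first Right (Y + nimber m)"
  proof cases
    case 1
    obtain c where "wins_second Right (F (n - i) + nimber c)"
      by (rule right_cancels_heap)
    then have "wins_second Right (F (n - i) + nimber c + down)"
      using down by (rule wins_second_add)
    then show ?thesis
      using 1 by (intro respond_star [of _ _ c]) (simp add: ac_simps)
  next
    case 2
    obtain c where c: "wins_second Right (F n + nimber c)"
      by (rule right_cancels_heap)
    obtain d where d: "nimber 1 + nimber c \<simeq> nimber d"
      using impartial_value_nimber [OF impartial_add] impartial_nimber by blast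
    have "nimber c + F n \<simeq> nimber 1 + nimber 1 + (nimber c + F n)"
      by (rule value_eq_sym [OF value_eq_double_nimber])
    also have "\<dots> = nimber 1 + nimber c + (nimber 1 + F n)"
      by (simp add: ac_simps)
    also have "\<dots> \<simeq> nimber d + (nimber 1 + F n)"
      by (rule value_eq_add [OF d])
    finally have "wins_second Right (F n + nimber 1 + nimber d)"
      using c value_eq_wins by (simp add: ac_simps)
    then show ?thesis
      using 2 by (intro respond_star [of _ _ d]) simp
  qed
next
  have down: "wins_second Right down"
    using wins_second_arrow [of Right] by simp
  fix j :: nat
  consider "n \<le> a" | "a < n" "j = 0" | "a < n" "0 < j"
    by linarith
  then show "wins_moving_first Right (F n + down + nimber j)"
  proof cases
    case 1
    then have "impartial (F n + nimber j)"
      by (intro impartial_add impartial_F) auto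
    then have "wins_moving_first Right (F n + nimber j + arrow Right)"
      by (rule wins_first_impartial_arrow)
    then show ?thesis
      by (simp add: ac_simps)
  next
    case 2
    then show ?thesis
      using right_wins_heap [of n] down wins_first_add by (simp add: nimber_0)
  next
    case 3
    then have "wins_second Right (F n + down)"
      using right_wins_heap [of n] down wins_second_add by blast
    then show ?thesis
      using 3 by (intro wins_first_addI2 [of 0]) (auto intro!: exI [of _ 0] simp: nimber_0)
  qed
qed

lemma full_support_equiv_downs:
  assumes "k * a < n" "n \<le> (k + 1) * a"
  shows "far_star_equiv (F n) (copies k down)"
proof (rule far_star_equivI)
  have minus: "- copies k down = U k"
    by (simp add: uminus_copies down_def)
  show "far_wins Left (F n + - copies k down + up)"
    using left_far_wins [of "k + 1" n] assms(2) unfolding minus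
    by (simp add: copies_Suc ac_simps)
  show "far_wins Right (F n + - copies k down + down)"
  proof (cases k)
    case 0
    then show ?thesis
      using right_far_wins_down unfolding minus by simp
  next
    case (Suc r)
    have "far_wins Right (F n + U r)"
      using assms(1) Suc by (intro right_far_wins) simp
    moreover have "(up + down) + (F n + U r) \<simeq> F n + U r"
      unfolding down_def by (intro value_eq_add_zero is_zero_add_uminus)
    ultimately show ?thesis
      using far_wins_cong unfolding minus by (simp add: Suc copies_Suc ac_simps)
  qed
qed

end

end

theorem theorem2:
  fixes a b n :: nat
  assumes "0 < a" and "0 < b" and "0 < n" and "a \<le> b"
  shows "(a = b \<longrightarrow> has_atomic_weight (full_support n a b) 0) \<and>
         (a < b \<longrightarrow> has_atomic_weight (full_support n a b) (- \<lceil>real n / real a\<rceil> + 1))"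
proof (intro conjI impI)
  assume "a = b"
  then show "has_atomic_weight (full_support n a b) 0"
    using impartial_far_star_equiv_zero [OF impartial_full_support_same]
    by (simp add: has_atomic_weight_def up_multiple_def)
next
  assume "a < b"
  \<comment> \<open>This is \<open>\<lceil>n / a\<rceil> - 1\<close>, and \<open>n - 1\<close> makes the quotient right when \<open>a\<close> divides \<open>n\<close>.\<close>
  define k where "k = (n - 1) div a"
  have k: "k * a < n" "n \<le> (k + 1) * a"
  proof -
    have "k * a + (n - 1) mod a = n - 1" "(n - 1) mod a < a"
      using assms(1) by (simp_all add: k_def)
    then show "k * a < n" "n \<le> (k + 1) * a"
      using assms(3) by (auto simp: distrib_right)
  qed
  have "\<lceil>real n / real a\<rceil> = int k + 1"
  proof (rule ceiling_unique)
    show "of_int (int k + 1) - 1 < real n / real a"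
      using k(1) assms(1) by (simp add: pos_less_divide_eq flip: of_nat_mult)
    have "real n \<le> real ((k + 1) * a)"
      using k(2) of_nat_le_iff by blast
    then show "real n / real a \<le> of_int (int k + 1)"
      using assms(1) by (simp add: pos_divide_le_eq distrib_right)
  qed
  moreover have "up_multiple (- int k) = copies k down"
    by (cases "k = 0") (simp_all add: up_multiple_def)
  ultimately show "has_atomic_weight (full_support n a b) (- \<lceil>real n / real a\<rceil> + 1)"
    using full_support_equiv_downs [OF assms(1,4) \<open>a < b\<close> k]
    by (simp add: has_atomic_weight_def)
qed

end
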